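(* For any $\mathcal{A}$ in $[\mathbf{Set},\mathbf{SupL}]$, (structural) consequence relations on $\mathcal{A}$ and quotients of $\mathcal{A}$ correspond bijectively to each other.
   Context: A suplattice is a poset with arbitrary joins; $\mathbf{SupL}$ is the category of suplattices and maps preserving arbitrary joins. $[\mathbf{Set},\mathbf{SupL}]$ is the category of functors $\mathbf{Set}\to\mathbf{SupL}$ and natural transformations. A consequence relation on a suplattice $P$ is a preorder $\vdash$ on $P$ such that $x \ge y$ implies $x \vdash y$, and for every $x \in P$, $x \vdash \bigvee\{y \in P \mid x \vdash y\}$. A (structural) consequence relation on a functor $\mathcal{A} : \mathbf{Set}\to\mathbf{SupL}$ is a subfunctor $\vdash$ of $A \times A$, where $A : \mathbf{Set}\to\mathbf{Set}$ is the composite of $\mathcal{A}$ with the forgetful functor $\mathbf{SupL}\to\mathbf{Set}$, such that for every set $X$ the component $\vdash_X$ is a consequence relation on the suplattice $\mathcal{A}X$. Being a subfunctor means that for every map $f : X \to Y$ and all $x,y\in \mathcal{A}X$, $x \vdash_X y$ implies $\mathcal{A}f(x) \vdash_Y \mathcal{A}f(y)$. A quotient of $\mathcal{A}$ is a natural transformation $q : \mathcal{A} \to \mathcal{B}$ in $[\mathbf{Set},\mathbf{SupL}]$ all of whose components $q_X : \mathcal{A}X \to \mathcal{B}X$ are surjective, considered up to isomorphism: $q_1 : \mathcal{A}\to\mathcal{B}_1$ and $q_2 : \mathcal{A}\to\mathcal{B}_2$ represent the same quotient if and only if there is a natural isomorphism $\theta : \mathcal{B}_1 \cong \mathcal{B}_2$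 in $[\mathbf{Set},\mathbf{SupL}]$ with $\theta_X(q_{1,X}(x)) = q_{2,X}(x)$ for every set $X$ and every $x \in \mathcal{A}X$. *)

theory Defs
  imports "HOL-Algebra.Complete_Lattice" "HOL-Library.FuncSet"
begin

text \<open>
  The library's \<^const>\<open>complete_lattice\<close> and \<^const>\<open>sup_pres\<close> also ask for the existence of
  infima; a suplattice is only asked for joins, as usual in the category of suplattices.
\<close>

locale suplattice = partial_order L for L (structure) +
  assumes sup_exists: "S \<subseteq> carrier L \<Longrightarrow> \<exists>s. least L s (Upper L S)"

definition sup_hom ::
    "('a, 'm) gorder_scheme \<Rightarrow> ('b, 'n) gorder_scheme \<Rightarrow> ('a \<Rightarrow> 'b) set" where
  "sup_hom P Q = {h \<in> carrier P \<rightarrow> carrier Q.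
     \<forall>S. S \<subseteq> carrier P \<longrightarrow> h (\<Squnion>\<^bsub>P\<^esub>S) = \<Squnion>\<^bsub>Q\<^esub>(h ` S)}"

text \<open>
  The category of sets is rendered as follows. HOL has no type of all sets, so the class of
  objects is a parameter \<open>U\<close>, a collection of subsets of an arbitrary type \<open>'u\<close>, and a map
  \<open>X \<rightarrow> Y\<close> is an element of the extensional function space, so that maps are equal as soon as
  they agree on \<open>X\<close>. With \<open>U = UNIV\<close> one obtains all subsets of \<open>'u\<close>; if \<open>'u\<close> is a type modelling
  set theory and \<open>U\<close> the collection of its small subsets, one obtains all sets.

  In \<open>farr F X Y f\<close> the domain and codomain are given explicitly, since they cannot be
  recovered from the function \<open>f\<close>. The values of \<open>fobj\<close>, \<open>farr\<close> and of the components of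
  transformations are irrelevant outside \<open>U\<close>, outside the function spaces and outside the
  carriers.
\<close>

record ('u, 'b) set_supl_functor =
  fobj :: "'u set \<Rightarrow> 'b gorder"
  farr :: "'u set \<Rightarrow> 'u set \<Rightarrow> ('u \<Rightarrow> 'u) \<Rightarrow> 'b \<Rightarrow> 'b"

abbreviation fcarrier :: "('u, 'b) set_supl_functor \<Rightarrow> 'u set \<Rightarrow> 'b set" where
  "fcarrier F X \<equiv> carrier (fobj F X)"

definition is_functor :: "'u set set \<Rightarrow> ('u, 'b) set_supl_functor \<Rightarrow> bool" where
  "is_functor U F \<longleftrightarrow>
     (\<forall>X\<in>U. suplattice (fobj F X)) \<and>
     (\<forall>X\<in>U. \<forall>Y\<in>U. \<forall>f \<in> X \<rightarrow>\<^sub>E Y. farr F X Y f \<in> sup_hom (fobj F X) (fobj F Y)) \<and>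
     (\<forall>X\<in>U. \<forall>a \<in> fcarrier F X. farr F X X (\<lambda>x\<in>X. x) a = a) \<and>
     (\<forall>X\<in>U. \<forall>Y\<in>U. \<forall>Z\<in>U. \<forall>f \<in> X \<rightarrow>\<^sub>E Y. \<forall>g \<in> Y \<rightarrow>\<^sub>E Z. \<forall>a \<in> fcarrier F X.
        farr F X Z (compose X g f) a = farr F Y Z g (farr F X Y f a))"

definition nat_trans ::
    "'u set set \<Rightarrow> ('u, 'b) set_supl_functor \<Rightarrow> ('u, 'c) set_supl_functor
      \<Rightarrow> ('u set \<Rightarrow> 'b \<Rightarrow> 'c) \<Rightarrow> bool" where
  "nat_trans U F G t \<longleftrightarrow>
     (\<forall>X\<in>U. t X \<in> sup_hom (fobj F X) (fobj G X)) \<and>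
     (\<forall>X\<in>U. \<forall>Y\<in>U. \<forall>f \<in> X \<rightarrow>\<^sub>E Y. \<forall>a \<in> fcarrier F X.
        t Y (farr F X Y f a) = farr G X Y f (t X a))"

definition nat_iso ::
    "'u set set \<Rightarrow> ('u, 'b) set_supl_functor \<Rightarrow> ('u, 'c) set_supl_functor
      \<Rightarrow> ('u set \<Rightarrow> 'b \<Rightarrow> 'c) \<Rightarrow> bool" where
  "nat_iso U F G t \<longleftrightarrow> nat_trans U F G t \<and>
     (\<exists>s. nat_trans U G F s \<and>
        (\<forall>X\<in>U. \<forall>a \<in> fcarrier F X. s X (t X a) = a) \<and>
        (\<forall>X\<in>U. \<forall>b \<in> fcarrier G X. t X (s X b) = b))"

definition consequence_relation :: "('a, 'm) gorder_scheme \<Rightarrow> 'a rel \<Rightarrow> bool" where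
  "consequence_relation P R \<longleftrightarrow>
     preorder_on (carrier P) R \<and>
     (\<forall>x \<in> carrier P. \<forall>y \<in> carrier P. y \<sqsubseteq>\<^bsub>P\<^esub> x \<longrightarrow> (x, y) \<in> R) \<and>
     (\<forall>x \<in> carrier P. (x, \<Squnion>\<^bsub>P\<^esub>{y \<in> carrier P. (x, y) \<in> R}) \<in> R)"

text \<open>
  The first conjunct makes equality of structural consequence relations the equality of their
  components at the objects in \<open>U\<close>.
\<close>

definition structural_consequence_relations ::
    "'u set set \<Rightarrow> ('u, 'b) set_supl_functor \<Rightarrow> ('u set \<Rightarrow> 'b rel) set" where
  "structural_consequence_relations U A = {R.
     (\<forall>X. X \<notin> U \<longrightarrow> R X = {}) \<and>
     (\<forall>X\<in>U. consequence_relation (fobj A X) (R X)) \<and>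
     (\<forall>X\<in>U. \<forall>Y\<in>U. \<forall>f \<in> X \<rightarrow>\<^sub>E Y. \<forall>x y.
        (x, y) \<in> R X \<longrightarrow> (farr A X Y f x, farr A X Y f y) \<in> R Y)}"

type_synonym ('u, 'b, 'c) quotient_map =
  "('u, 'c) set_supl_functor \<times> ('u set \<Rightarrow> 'b \<Rightarrow> 'c)"

definition quotient_maps ::
    "'u set set \<Rightarrow> ('u, 'b) set_supl_functor \<Rightarrow> ('u, 'b, 'c) quotient_map set" where
  "quotient_maps U A = {(B, q). is_functor U B \<and> nat_trans U A B q \<and>
     (\<forall>X\<in>U. q X ` fcarrier A X = fcarrier B X)}"

definition same_quotient ::
    "'u set set \<Rightarrow> ('u, 'b) set_supl_functor
      \<Rightarrow> ('u, 'b, 'c) quotient_map \<Rightarrow> ('u, 'b, 'd) quotient_map \<Rightarrow> bool" where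
  "same_quotient U A Q1 Q2 \<longleftrightarrow>
     (\<exists>t. nat_iso U (fst Q1) (fst Q2) t \<and>
        (\<forall>X\<in>U. \<forall>x \<in> fcarrier A X. t X (snd Q1 X x) = snd Q2 X x))"

definition same_quotient_rel ::
    "'u set set \<Rightarrow> ('u, 'b) set_supl_functor \<Rightarrow> ('u, 'b, 'c) quotient_map rel" where
  "same_quotient_rel U A =
     {(Q1, Q2) \<in> quotient_maps U A \<times> quotient_maps U A. same_quotient U A Q1 Q2}"

text \<open>
  Consequences point downwards (\<open>x \<ge> y\<close> implies \<open>x \<turnstile> y\<close>), so \<open>x \<turnstile> y\<close> holds in the relation induced
  by \<open>q\<close> when \<open>q y \<le> q x\<close>.
\<close>

definition induced_consequence ::
    "'u set set \<Rightarrow> ('u, 'b) set_supl_functor \<Rightarrow> ('u, 'b, 'c) quotient_map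
      \<Rightarrow> 'u set \<Rightarrow> 'b rel" where
  "induced_consequence U A Q X =
     (if X \<in> U
      then {(x, y) \<in> fcarrier A X \<times> fcarrier A X. snd Q X y \<sqsubseteq>\<^bsub>fobj (fst Q) X\<^esub> snd Q X x}
      else {})"

end

theory Submission
  imports Defs
begin

text \<open>
  A surjection \<open>q\<close> of suplattices is determined up to isomorphism by the preorder \<open>q y \<le> q x\<close> that it
  pulls back, since its codomain is the poset reflection of that preorder. Preservation of joins
  by \<open>q\<close> makes this preorder a consequence relation, and naturality makes it structural
  (\<open>induced_consequence_structural\<close>). Conversely, inclusion of two such preorders yields a map
  between the codomains, and surjectivity makes that map preserve joins and commute with the
  functors' actions (\<open>quotient_factorization\<close>). Hence two quotients are the same exactly when they
  induce the same relation.

  Every structural consequence relation arises in this way. On each \<open>fobj A X\<close> let \<open>c x\<close> be the join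
  of all consequences of \<open>x\<close>. The axioms say that \<open>x \<turnstile> y\<close> holds if and only if \<open>y \<le> c x\<close>, and from
  this \<open>c\<close> is a closure operator with \<open>x \<turnstile> y\<close> if and only if \<open>c y \<le> c x\<close>. Its fixed points form a
  suplattice, in which the join is the closure of the join of \<open>fobj A X\<close>, and \<open>c\<close> is a surjective
  homomorphism onto it. Structurality gives \<open>c (f (c x)) = c (f x)\<close>, where \<open>f\<close> stands for the action
  of a map, so that \<open>c \<circ> f\<close> turns the fixed points into a functor and \<open>c\<close> into a quotient whose
  relation is the given one (\<open>theory_quotient\<close>).

  The map from quotients to relations is therefore surjective and its kernel is sameness of
  quotients, so its fibres give the bijection. Because fixed points are elements of \<open>A\<close>, each
  quotient, with values in any type, has a representative with values in the type of \<open>A\<close>.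
\<close>

section \<open>Suplattices and their homomorphisms\<close>

context suplattice
begin

lemma sup_least: "S \<subseteq> carrier L \<Longrightarrow> least L (\<Squnion>S) (Upper L S)"
  unfolding sup_def by (rule someI_ex) (rule sup_exists)

lemma sup_closed: "S \<subseteq> carrier L \<Longrightarrow> \<Squnion>S \<in> carrier L"
  using sup_least by (rule least_closed)

lemma sup_upper: "S \<subseteq> carrier L \<Longrightarrow> x \<in> S \<Longrightarrow> x \<sqsubseteq> \<Squnion>S"
  by (rule least_Upper_above[OF sup_least])

lemma sup_le:
  assumes "S \<subseteq> carrier L" "z \<in> carrier L" "\<And>x. x \<in> S \<Longrightarrow> x \<sqsubseteq> z"
  shows "\<Squnion>S \<sqsubseteq> z"
  using assms by (intro least_le[OF sup_least] Upper_memI)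

lemma sup_eqI:
  assumes "S \<subseteq> carrier L" "z \<in> carrier L"
    and "\<And>x. x \<in> S \<Longrightarrow> x \<sqsubseteq> z"
    and "\<And>w. w \<in> carrier L \<Longrightarrow> (\<And>x. x \<in> S \<Longrightarrow> x \<sqsubseteq> w) \<Longrightarrow> z \<sqsubseteq> w"
  shows "\<Squnion>S = z"
proof (rule le_antisym)
  show "\<Squnion>S \<sqsubseteq> z" using assms(1-3) by (rule sup_le)
  show "z \<sqsubseteq> \<Squnion>S" using assms(1) by (intro assms(4) sup_closed sup_upper)
qed (use assms sup_closed in auto)

end

lemma sup_hom_closed: "h \<in> sup_hom P Q \<Longrightarrow> x \<in> carrier P \<Longrightarrow> h x \<in> carrier Q"
  by (auto simp: sup_hom_def)

lemma sup_hom_sup: "h \<in> sup_hom P Q \<Longrightarrow> S \<subseteq> carrier P \<Longrightarrow> h (\<Squnion>\<^bsub>P\<^esub>S) = \<Squnion>\<^bsub>Q\<^esub>(h ` S)"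
  by (auto simp: sup_hom_def)

lemma sup_hom_mono:
  assumes "suplattice P" "suplattice Q" and h: "h \<in> sup_hom P Q"
    and x: "x \<in> carrier P" and y: "y \<in> carrier P" and "x \<sqsubseteq>\<^bsub>P\<^esub> y"
  shows "h x \<sqsubseteq>\<^bsub>Q\<^esub> h y"
proof -
  interpret P: suplattice P by fact
  interpret Q: suplattice Q by fact
  have "\<Squnion>\<^bsub>P\<^esub>{x, y} = y"
    using assms by (intro P.sup_eqI) auto
  then have "h y = \<Squnion>\<^bsub>Q\<^esub>(h ` {x, y})"
    using sup_hom_sup[OF h, of "{x, y}"] x y by simp
  moreover have "h x \<sqsubseteq>\<^bsub>Q\<^esub> \<Squnion>\<^bsub>Q\<^esub>(h ` {x, y})"
    using sup_hom_closed[OF h] x y by (intro Q.sup_upper) auto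
  ultimately show ?thesis by simp
qed

lemma sup_hom_comp:
  assumes g: "g \<in> sup_hom P Q" and h: "h \<in> sup_hom Q R"
  shows "(\<lambda>x. h (g x)) \<in> sup_hom P R"
proof -
  have "h (g (\<Squnion>\<^bsub>P\<^esub>S)) = \<Squnion>\<^bsub>R\<^esub>((\<lambda>x. h (g x)) ` S)" if "S \<subseteq> carrier P" for S
  proof -
    have "g ` S \<subseteq> carrier Q" using that sup_hom_closed[OF g] by auto
    then show ?thesis
      using sup_hom_sup[OF g that] sup_hom_sup[OF h, of "g ` S"] by (simp add: image_image)
  qed
  then show ?thesis
    using sup_hom_closed[OF g] sup_hom_closed[OF h] by (auto simp: sup_hom_def)
qed

text \<open>
  Every set of elements of \<open>Q\<close> is the image of a set of elements of \<open>P\<close>, so joins in \<open>Q\<close> can be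
  computed in \<open>P\<close>. This is how each map out of a quotient is seen to preserve joins.
\<close>

lemma sup_hom_factor:
  assumes q: "q \<in> sup_hom P Q" and surj: "q ` carrier P = carrier Q"
    and g: "g \<in> sup_hom P R" and P: "suplattice P"
    and tq: "\<And>x. x \<in> carrier P \<Longrightarrow> t (q x) = g x"
  shows "t \<in> sup_hom Q R"
proof -
  interpret P: suplattice P by fact
  have "t y \<in> carrier R" if "y \<in> carrier Q" for y
    using that tq sup_hom_closed[OF g] unfolding surj[symmetric] by auto
  moreover have "t (\<Squnion>\<^bsub>Q\<^esub>S) = \<Squnion>\<^bsub>R\<^esub>(t ` S)" if "S \<subseteq> carrier Q" for S
  proof -
    from that surj obtain S' where S': "S' \<subseteq> carrier P" "S = q ` S'"
      by (metis subset_imageE)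
    have "t (\<Squnion>\<^bsub>Q\<^esub>S) = g (\<Squnion>\<^bsub>P\<^esub>S')"
      using S' sup_hom_sup[OF q S'(1)] tq[OF P.sup_closed[OF S'(1)]] by simp
    also have "\<dots> = \<Squnion>\<^bsub>R\<^esub>(g ` S')"
      using S' sup_hom_sup[OF g] by simp
    also have "g ` S' = t ` S"
      using S' tq by (force simp: image_image)
    finally show ?thesis .
  qed
  ultimately show ?thesis by (auto simp: sup_hom_def)
qed

section \<open>Consequence relations as closure operators\<close>

definition consequence_closure :: "('a, 'm) gorder_scheme \<Rightarrow> 'a rel \<Rightarrow> 'a \<Rightarrow> 'a" where
  "consequence_closure P R x = \<Squnion>\<^bsub>P\<^esub>{y \<in> carrier P. (x, y) \<in> R}"

text \<open>
  Closed elements are the deductively closed theories. They represent the classes of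
  interderivable elements, which keeps the quotient inside the type of \<open>P\<close>.
\<close>

definition theory_lattice :: "'a gorder \<Rightarrow> 'a rel \<Rightarrow> 'a gorder" where
  "theory_lattice P R = P\<lparr>carrier := {x \<in> carrier P. consequence_closure P R x = x}\<rparr>"

locale suplattice_consequence = suplattice P for P :: "'a gorder" (structure) +
  fixes R :: "'a rel"
  assumes consequence: "consequence_relation P R"
begin

abbreviation "c \<equiv> consequence_closure P R"

lemma rel_refl: "x \<in> carrier P \<Longrightarrow> (x, x) \<in> R"
  using consequence by (auto simp: consequence_relation_def preorder_on_def refl_on_def)

lemma rel_closed: "(x, y) \<in> R \<Longrightarrow> x \<in> carrier P \<and> y \<in> carrier P"
  using consequence by (auto simp: consequence_relation_def preorder_on_def)

lemma rel_trans: "(x, y) \<in> R \<Longrightarrow> (y, z) \<in> R \<Longrightarrow> (x, z) \<in> R"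
  using consequence by (auto simp: consequence_relation_def preorder_on_def dest: transD)

lemma rel_of_le: "x \<in> carrier P \<Longrightarrow> y \<in> carrier P \<Longrightarrow> y \<sqsubseteq> x \<Longrightarrow> (x, y) \<in> R"
  using consequence by (auto simp: consequence_relation_def)

lemma rel_closure: "x \<in> carrier P \<Longrightarrow> (x, c x) \<in> R"
  using consequence by (auto simp: consequence_relation_def consequence_closure_def)

lemma closure_closed: "x \<in> carrier P \<Longrightarrow> c x \<in> carrier P"
  unfolding consequence_closure_def by (rule sup_closed) auto

lemma rel_iff_le_closure:
  assumes "x \<in> carrier P" "y \<in> carrier P"
  shows "(x, y) \<in> R \<longleftrightarrow> y \<sqsubseteq> c x"
proof
  assume "(x, y) \<in> R"
  then show "y \<sqsubseteq> c x"
    unfolding consequence_closure_def using assms by (intro sup_upper) auto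
next
  assume "y \<sqsubseteq> c x"
  then have "(c x, y) \<in> R"
    using assms by (intro rel_of_le closure_closed)
  with rel_closure[OF assms(1)] show "(x, y) \<in> R" by (rule rel_trans)
qed

lemma le_closure: "x \<in> carrier P \<Longrightarrow> x \<sqsubseteq> c x"
  using rel_iff_le_closure rel_refl by blast

lemma rel_iff_closure_le:
  assumes "x \<in> carrier P" "y \<in> carrier P"
  shows "(x, y) \<in> R \<longleftrightarrow> c y \<sqsubseteq> c x"
proof
  assume "(x, y) \<in> R"
  then have "(x, c y) \<in> R" using rel_closure[OF assms(2)] by (rule rel_trans)
  then show "c y \<sqsubseteq> c x" using assms rel_iff_le_closure closure_closed by simp
next
  assume "c y \<sqsubseteq> c x"
  then have "y \<sqsubseteq> c x" using assms le_closure closure_closed le_trans by meson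
  then show "(x, y) \<in> R" using assms rel_iff_le_closure by simp
qed

lemma closure_eqI: "(x, y) \<in> R \<Longrightarrow> (y, x) \<in> R \<Longrightarrow> c x = c y"
  using rel_closed rel_iff_closure_le closure_closed by (meson le_antisym)

lemma closure_idem: "x \<in> carrier P \<Longrightarrow> c (c x) = c x"
  by (rule closure_eqI) (simp_all add: rel_closure rel_of_le le_closure closure_closed)

lemma carrier_theory_lattice: "carrier (theory_lattice P R) = c ` carrier P"
  unfolding theory_lattice_def using closure_idem closure_closed by (auto simp: image_iff) metis

text \<open>
  Joins of closed elements are closures of joins: an upper bound \<open>w = c w\<close> of the \<open>c s\<close> lies above
  every \<open>s\<close>, hence above \<open>\<Squnion>S\<close>, hence above \<open>c (\<Squnion>S)\<close>.
\<close>

lemma closure_sup_least: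
  assumes S: "S \<subseteq> carrier P"
  shows "least (theory_lattice P R) (c (\<Squnion>S)) (Upper (theory_lattice P R) (c ` S))"
proof (rule least_UpperI)
  fix x assume "x \<in> c ` S"
  then obtain s where s: "s \<in> S" "x = c s" by auto
  have "(\<Squnion>S, s) \<in> R"
    using S s sup_upper sup_closed by (intro rel_of_le) auto
  then show "x \<sqsubseteq>\<^bsub>theory_lattice P R\<^esub> c (\<Squnion>S)"
    using S s rel_iff_closure_le[of "\<Squnion>S" s] sup_closed by (auto simp: theory_lattice_def)
next
  fix w assume w: "w \<in> Upper (theory_lattice P R) (c ` S)"
  then have wc: "w \<in> carrier P" "c w = w"
    by (auto simp: Upper_def theory_lattice_def)
  have "s \<sqsubseteq> w" if "s \<in> S" for s
  proof -
    have "c s \<sqsubseteq> w"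
      using w that S closure_closed[of s] closure_idem[of s]
      by (auto simp: Upper_def theory_lattice_def)
    with that S wc show ?thesis
      by (meson le_closure closure_closed le_trans subsetD)
  qed
  then have "\<Squnion>S \<sqsubseteq> w" using S wc by (intro sup_le)
  then have "(w, \<Squnion>S) \<in> R" using S wc sup_closed by (intro rel_of_le)
  then show "c (\<Squnion>S) \<sqsubseteq>\<^bsub>theory_lattice P R\<^esub> w"
    using wc S sup_closed rel_iff_closure_le by (simp add: theory_lattice_def)
next
  show "c ` S \<subseteq> carrier (theory_lattice P R)"
    using S carrier_theory_lattice by auto
  show "c (\<Squnion>S) \<in> carrier (theory_lattice P R)"
    using S sup_closed carrier_theory_lattice by auto
qed

lemma suplattice_theory_lattice: "suplattice (theory_lattice P R)"
proof -
  let ?T = "theory_lattice P R"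
  have po: "partial_order ?T"
  proof unfold_locales
    show "(.=\<^bsub>?T\<^esub>) = (=)" by (simp add: theory_lattice_def eq_is_equal)
  qed (auto simp: theory_lattice_def eq_is_equal intro: le_trans)
  show ?thesis
  proof (intro suplattice.intro[OF po] suplattice_axioms.intro)
    fix S assume "S \<subseteq> carrier ?T"
    then obtain S' where "S' \<subseteq> carrier P" "S = c ` S'"
      unfolding carrier_theory_lattice by (metis subset_imageE)
    then show "\<exists>s. least ?T s (Upper ?T S)"
      using closure_sup_least by auto
  qed
qed

lemma closure_sup_hom: "c \<in> sup_hom P (theory_lattice P R)"
proof -
  interpret T: suplattice "theory_lattice P R" by (rule suplattice_theory_lattice)
  have "c (\<Squnion>S) = \<Squnion>\<^bsub>theory_lattice P R\<^esub>(c ` S)" if "S \<subseteq> carrier P" for S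
  proof -
    have "c ` S \<subseteq> carrier (theory_lattice P R)"
      using that carrier_theory_lattice by auto
    then show ?thesis
      using T.least_unique[OF closure_sup_least[OF that] T.sup_least] by simp
  qed
  then show ?thesis by (auto simp: sup_hom_def carrier_theory_lattice)
qed

end

section \<open>The consequence relation of a quotient\<close>

lemma quotient_mapsD:
  assumes "Q \<in> quotient_maps U A"
  shows "is_functor U (fst Q)" "nat_trans U A (fst Q) (snd Q)"
    and "X \<in> U \<Longrightarrow> snd Q X ` fcarrier A X = fcarrier (fst Q) X"
  using assms unfolding quotient_maps_def by fastforce+

lemma functor_suplattice: "is_functor U F \<Longrightarrow> X \<in> U \<Longrightarrow> suplattice (fobj F X)"
  by (simp add: is_functor_def)

lemma functor_sup_hom:
  "is_functor U F \<Longrightarrow> X \<in> U \<Longrightarrow> Y \<in> U \<Longrightarrow> f \<in> X \<rightarrow>\<^sub>E Y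
    \<Longrightarrow> farr F X Y f \<in> sup_hom (fobj F X) (fobj F Y)"
  by (simp add: is_functor_def)

lemma functor_closed:
  "is_functor U F \<Longrightarrow> X \<in> U \<Longrightarrow> Y \<in> U \<Longrightarrow> f \<in> X \<rightarrow>\<^sub>E Y \<Longrightarrow> a \<in> fcarrier F X
    \<Longrightarrow> farr F X Y f a \<in> fcarrier F Y"
  by (rule sup_hom_closed[OF functor_sup_hom])

lemma nat_trans_sup_hom: "nat_trans U F G t \<Longrightarrow> X \<in> U \<Longrightarrow> t X \<in> sup_hom (fobj F X) (fobj G X)"
  by (simp add: nat_trans_def)

lemma nat_trans_natural:
  "nat_trans U F G t \<Longrightarrow> X \<in> U \<Longrightarrow> Y \<in> U \<Longrightarrow> f \<in> X \<rightarrow>\<^sub>E Y \<Longrightarrow> a \<in> fcarrier F X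
    \<Longrightarrow> t Y (farr F X Y f a) = farr G X Y f (t X a)"
  by (simp add: nat_trans_def)

lemma mem_induced_consequence:
  "X \<in> U \<Longrightarrow> (x, y) \<in> induced_consequence U A Q X \<longleftrightarrow>
     x \<in> fcarrier A X \<and> y \<in> fcarrier A X \<and> snd Q X y \<sqsubseteq>\<^bsub>fobj (fst Q) X\<^esub> snd Q X x"
  by (simp add: induced_consequence_def)

text \<open>
  The two axioms that go beyond the order come from the two properties of \<open>q\<close>: since \<open>q\<close> preserves
  joins, \<open>q (\<Squnion>{y. x \<turnstile> y})\<close> is a join of elements below \<open>q x\<close>; and since \<open>q\<close> is natural and the
  maps \<open>farr B X Y f\<close> are monotone, the relation is structural.
\<close>

lemma induced_consequence_structural:
  assumes A: "is_functor U A" and Q: "Q \<in> quotient_maps U A"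
  shows "induced_consequence U A Q \<in> structural_consequence_relations U A"
proof -
  obtain B q where Qeq: "Q = (B, q)" by (cases Q)
  have B: "is_functor U B" and q: "nat_trans U A B q"
    using quotient_mapsD[OF Q] Qeq by auto
  let ?R = "induced_consequence U A Q"
  have mem: "(x, y) \<in> ?R X \<longleftrightarrow>
      x \<in> fcarrier A X \<and> y \<in> fcarrier A X \<and> q X y \<sqsubseteq>\<^bsub>fobj B X\<^esub> q X x" if "X \<in> U" for X x y
    using mem_induced_consequence[OF that, of x y A Q] Qeq by simp
  have "consequence_relation (fobj A X) (?R X)" if X: "X \<in> U" for X
  proof -
    interpret P: suplattice "fobj A X" using functor_suplattice[OF A X] .
    interpret B: suplattice "fobj B X" using functor_suplattice[OF B X] .
    note qX = nat_trans_sup_hom[OF q X]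
    note qc = sup_hom_closed[OF qX]
    have "preorder_on (fcarrier A X) (?R X)"
      unfolding preorder_on_def
    proof (intro conjI)
      show "?R X \<subseteq> fcarrier A X \<times> fcarrier A X" using mem[OF X] by auto
      show "refl_on (fcarrier A X) (?R X)" using mem[OF X] qc by (auto simp: refl_on_def)
      show "trans (?R X)"
        using mem[OF X] qc by (intro transI) (meson B.le_trans)
    qed
    moreover have "(x, \<Squnion>\<^bsub>fobj A X\<^esub>{y \<in> fcarrier A X. (x, y) \<in> ?R X}) \<in> ?R X"
      if x: "x \<in> fcarrier A X" for x
    proof -
      let ?S = "{y \<in> fcarrier A X. (x, y) \<in> ?R X}"
      have "\<Squnion>\<^bsub>fobj B X\<^esub>(q X ` ?S) \<sqsubseteq>\<^bsub>fobj B X\<^esub> q X x"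
        using qc x mem[OF X] by (intro B.sup_le) auto
      then have "q X (\<Squnion>\<^bsub>fobj A X\<^esub>?S) \<sqsubseteq>\<^bsub>fobj B X\<^esub> q X x"
        using sup_hom_sup[OF qX, of ?S] by simp
      then show ?thesis using mem[OF X] x P.sup_closed[of ?S] by simp
    qed
    moreover have "(x, y) \<in> ?R X"
      if "x \<in> fcarrier A X" "y \<in> fcarrier A X" "y \<sqsubseteq>\<^bsub>fobj A X\<^esub> x" for x y
      using that mem[OF X] sup_hom_mono[OF P.suplattice_axioms B.suplattice_axioms qX] by simp
    ultimately show ?thesis by (simp add: consequence_relation_def)
  qed
  moreover have "(farr A X Y f x, farr A X Y f y) \<in> ?R Y"
    if X: "X \<in> U" and Y: "Y \<in> U" and f: "f \<in> X \<rightarrow>\<^sub>E Y" and xy: "(x, y) \<in> ?R X" for X Y f x y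
  proof -
    have x: "x \<in> fcarrier A X" and y: "y \<in> fcarrier A X"
      and le: "q X y \<sqsubseteq>\<^bsub>fobj B X\<^esub> q X x"
      using xy mem[OF X] by auto
    have "farr B X Y f (q X y) \<sqsubseteq>\<^bsub>fobj B Y\<^esub> farr B X Y f (q X x)"
      using x y le sup_hom_closed[OF nat_trans_sup_hom[OF q X]]
      by (intro sup_hom_mono[OF functor_suplattice[OF B X] functor_suplattice[OF B Y]
            functor_sup_hom[OF B X Y f]])
    then show ?thesis
      using mem[OF Y] x y functor_closed[OF A X Y f] nat_trans_natural[OF q X Y f] by simp
  qed
  moreover have "?R X = {}" if "X \<notin> U" for X
    using that by (simp add: induced_consequence_def)
  ultimately show ?thesis
    by (simp add: structural_consequence_relations_def)
qed

section \<open>Quotients with the same consequence relation\<close>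

text \<open>
  The universal property of a quotient: every quotient with more consequences factors through it.
  Inclusion of the relations makes \<open>t (q x) = r x\<close> a valid definition of \<open>t\<close> because
  \<open>q x = q x'\<close> means \<open>x \<turnstile> x'\<close> and \<open>x' \<turnstile> x\<close>, which gives \<open>r x = r x'\<close> by antisymmetry.
\<close>

lemma quotient_factorization:
  fixes Q1 :: "('u, 'b, 'c) quotient_map" and Q2 :: "('u, 'b, 'd) quotient_map"
  assumes A: "is_functor U A" and Q1: "Q1 \<in> quotient_maps U A" and Q2: "Q2 \<in> quotient_maps U A"
    and le: "\<And>X. X \<in> U \<Longrightarrow> induced_consequence U A Q1 X \<subseteq> induced_consequence U A Q2 X"
  obtains t where "nat_trans U (fst Q1) (fst Q2) t"
    and "\<And>X x. X \<in> U \<Longrightarrow> x \<in> fcarrier A X \<Longrightarrow> t X (snd Q1 X x) = snd Q2 X x"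
proof -
  obtain B q where Q1eq: "Q1 = (B, q)" by (cases Q1)
  obtain C r where Q2eq: "Q2 = (C, r)" by (cases Q2)
  have B: "is_functor U B" and q: "nat_trans U A B q"
    and surj: "\<And>X. X \<in> U \<Longrightarrow> q X ` fcarrier A X = fcarrier B X"
    using quotient_mapsD[OF Q1] Q1eq by auto
  have C: "is_functor U C" and r: "nat_trans U A C r"
    using quotient_mapsD[OF Q2] Q2eq by auto
  define t where "t X b = r X (inv_into (fcarrier A X) (q X) b)" for X b
  have tq: "t X (q X x) = r X x" if X: "X \<in> U" and x: "x \<in> fcarrier A X" for X x
  proof -
    interpret B: suplattice "fobj B X" using functor_suplattice[OF B X] .
    interpret C: suplattice "fobj C X" using functor_suplattice[OF C X] .
    let ?x = "inv_into (fcarrier A X) (q X) (q X x)"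
    have x': "?x \<in> fcarrier A X" "q X ?x = q X x"
      using x by (auto intro: inv_into_into f_inv_into_f)
    have qx: "q X x \<in> fcarrier B X" using surj[OF X] x by auto
    have "(x, ?x) \<in> induced_consequence U A Q1 X" "(?x, x) \<in> induced_consequence U A Q1 X"
      using x x' qx X Q1eq by (simp_all add: mem_induced_consequence)
    then have "(x, ?x) \<in> induced_consequence U A Q2 X" "(?x, x) \<in> induced_consequence U A Q2 X"
      using le[OF X] by auto
    then have "r X ?x = r X x"
      using x x' sup_hom_closed[OF nat_trans_sup_hom[OF r X]] X Q2eq
      by (intro C.le_antisym) (simp_all add: mem_induced_consequence)
    then show ?thesis by (simp add: t_def)
  qed
  have "nat_trans U B C t"
    unfolding nat_trans_def
  proof (intro conjI ballI)
    fix X assume X: "X \<in> U"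
    show "t X \<in> sup_hom (fobj B X) (fobj C X)"
      using tq[OF X]
      by (rule sup_hom_factor[OF nat_trans_sup_hom[OF q X] surj[OF X] nat_trans_sup_hom[OF r X]
            functor_suplattice[OF A X]])
    fix Y f b assume Y: "Y \<in> U" and f: "f \<in> X \<rightarrow>\<^sub>E Y" and b: "b \<in> fcarrier B X"
    obtain a where a: "a \<in> fcarrier A X" "b = q X a" using b surj[OF X] by auto
    show "t Y (farr B X Y f b) = farr C X Y f (t X b)"
      using a tq X Y functor_closed[OF A X Y f] nat_trans_natural[OF q X Y f, symmetric]
        nat_trans_natural[OF r X Y f] by simp
  qed
  with tq that show ?thesis using Q1eq Q2eq by simp
qed

lemma same_quotient_if_induced_eq:
  assumes A: "is_functor U A" and Q1: "Q1 \<in> quotient_maps U A" and Q2: "Q2 \<in> quotient_maps U A"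
    and eq: "induced_consequence U A Q1 = induced_consequence U A Q2"
  shows "same_quotient U A Q1 Q2"
proof -
  obtain t where t: "nat_trans U (fst Q1) (fst Q2) t"
    and tq: "\<And>X x. X \<in> U \<Longrightarrow> x \<in> fcarrier A X \<Longrightarrow> t X (snd Q1 X x) = snd Q2 X x"
    using quotient_factorization[OF A Q1 Q2] eq by auto
  obtain s where s: "nat_trans U (fst Q2) (fst Q1) s"
    and sq: "\<And>X x. X \<in> U \<Longrightarrow> x \<in> fcarrier A X \<Longrightarrow> s X (snd Q2 X x) = snd Q1 X x"
    using quotient_factorization[OF A Q2 Q1] eq by auto
  have "s X (t X b) = b" if "X \<in> U" "b \<in> fcarrier (fst Q1) X" for X b
    using that tq sq by (auto simp: quotient_mapsD(3)[OF Q1, symmetric])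
  moreover have "t X (s X b) = b" if "X \<in> U" "b \<in> fcarrier (fst Q2) X" for X b
    using that tq sq by (auto simp: quotient_mapsD(3)[OF Q2, symmetric])
  ultimately have "nat_iso U (fst Q1) (fst Q2) t"
    unfolding nat_iso_def using t s by blast
  with tq show ?thesis unfolding same_quotient_def by blast
qed

lemma induced_eq_if_same_quotient:
  assumes Q1: "Q1 \<in> quotient_maps U A" and Q2: "Q2 \<in> quotient_maps U A"
    and same: "same_quotient U A Q1 Q2"
  shows "induced_consequence U A Q1 = induced_consequence U A Q2"
proof -
  obtain t where iso: "nat_iso U (fst Q1) (fst Q2) t"
    and tq: "\<And>X x. X \<in> U \<Longrightarrow> x \<in> fcarrier A X \<Longrightarrow> t X (snd Q1 X x) = snd Q2 X x"
    using same unfolding same_quotient_def by blast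
  then obtain s where t: "nat_trans U (fst Q1) (fst Q2) t" and s: "nat_trans U (fst Q2) (fst Q1) s"
    and st: "\<And>X a. X \<in> U \<Longrightarrow> a \<in> fcarrier (fst Q1) X \<Longrightarrow> s X (t X a) = a"
    unfolding nat_iso_def by blast
  have "(x, y) \<in> induced_consequence U A Q1 X \<longleftrightarrow> (x, y) \<in> induced_consequence U A Q2 X" for X x y
  proof (cases "X \<in> U \<and> x \<in> fcarrier A X \<and> y \<in> fcarrier A X")
    case True
    then have X: "X \<in> U" and x: "x \<in> fcarrier A X" and y: "y \<in> fcarrier A X" by auto
    note L1 = functor_suplattice[OF quotient_mapsD(1)[OF Q1] X]
    note L2 = functor_suplattice[OF quotient_mapsD(1)[OF Q2] X]
    have q1: "snd Q1 X x \<in> fcarrier (fst Q1) X" "snd Q1 X y \<in> fcarrier (fst Q1) X"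
      using x y quotient_mapsD(3)[OF Q1 X] by auto
    have q2: "snd Q2 X x \<in> fcarrier (fst Q2) X" "snd Q2 X y \<in> fcarrier (fst Q2) X"
      using x y quotient_mapsD(3)[OF Q2 X] by auto
    have sq: "s X (snd Q2 X x) = snd Q1 X x" "s X (snd Q2 X y) = snd Q1 X y"
      using st[OF X] q1 tq[OF X x] tq[OF X y] by metis+
    have "snd Q1 X y \<sqsubseteq>\<^bsub>fobj (fst Q1) X\<^esub> snd Q1 X x \<longleftrightarrow>
        snd Q2 X y \<sqsubseteq>\<^bsub>fobj (fst Q2) X\<^esub> snd Q2 X x"
      using sup_hom_mono[OF L1 L2 nat_trans_sup_hom[OF t X] q1(2,1)]
        sup_hom_mono[OF L2 L1 nat_trans_sup_hom[OF s X] q2(2,1)]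
        tq[OF X x] tq[OF X y] sq by auto
    then show ?thesis using X x y by (simp add: mem_induced_consequence)
  next
    case False
    then show ?thesis by (auto simp: induced_consequence_def)
  qed
  then show ?thesis by (intro ext set_eqI) auto
qed

section \<open>The quotient of a consequence relation\<close>

definition theory_functor ::
    "('u, 'b) set_supl_functor \<Rightarrow> ('u set \<Rightarrow> 'b rel) \<Rightarrow> ('u, 'b) set_supl_functor" where
  "theory_functor A R =
     \<lparr>fobj = (\<lambda>X. theory_lattice (fobj A X) (R X)),
      farr = (\<lambda>X Y f x. consequence_closure (fobj A Y) (R Y) (farr A X Y f x))\<rparr>"

definition theory_quotient ::
    "('u, 'b) set_supl_functor \<Rightarrow> ('u set \<Rightarrow> 'b rel) \<Rightarrow> ('u, 'b, 'b) quotient_map" where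
  "theory_quotient A R =
     (theory_functor A R, \<lambda>X. consequence_closure (fobj A X) (R X))"

lemma theory_quotient:
  assumes A: "is_functor U A" and R: "R \<in> structural_consequence_relations U A"
  shows "theory_quotient A R \<in> quotient_maps U A"
    and "induced_consequence U A (theory_quotient A R) = R"
proof -
  let ?B = "theory_functor A R"
  let ?c = "\<lambda>X. consequence_closure (fobj A X) (R X)"
  have cons: "suplattice_consequence (fobj A X) (R X)" if "X \<in> U" for X
    using R that functor_suplattice[OF A that]
    by (auto simp: structural_consequence_relations_def suplattice_consequence_def
        suplattice_consequence_axioms_def)
  have struct: "(farr A X Y f x, farr A X Y f y) \<in> R Y"
    if "X \<in> U" "Y \<in> U" "f \<in> X \<rightarrow>\<^sub>E Y" "(x, y) \<in> R X" for X Y f x y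
    using R that unfolding structural_consequence_relations_def by blast
  have obj: "fobj ?B X = theory_lattice (fobj A X) (R X)" for X
    by (simp add: theory_functor_def)
  have arr: "farr ?B X Y f x = ?c Y (farr A X Y f x)" for X Y f x
    by (simp add: theory_functor_def)
  have chom: "?c X \<in> sup_hom (fobj A X) (fobj ?B X)" if "X \<in> U" for X
    using suplattice_consequence.closure_sup_hom[OF cons[OF that]] by (simp add: obj)
  have surj: "?c X ` fcarrier A X = fcarrier ?B X" if "X \<in> U" for X
    using suplattice_consequence.carrier_theory_lattice[OF cons[OF that]] by (simp add: obj)
  \<comment> \<open>By structurality \<open>farr A X Y f\<close> sends the interderivable pair \<open>a\<close>, \<open>c a\<close> to an interderivable
    pair, so the closed elements form a functor for which closure is natural.\<close>
  have nat: "farr ?B X Y f (?c X a) = ?c Y (farr A X Y f a)"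
    if X: "X \<in> U" and Y: "Y \<in> U" and f: "f \<in> X \<rightarrow>\<^sub>E Y" and a: "a \<in> fcarrier A X" for X Y f a
  proof -
    interpret CX: suplattice_consequence "fobj A X" "R X" by (rule cons[OF X])
    interpret CY: suplattice_consequence "fobj A Y" "R Y" by (rule cons[OF Y])
    have "(a, ?c X a) \<in> R X" "(?c X a, a) \<in> R X"
      using a CX.rel_closure CX.rel_of_le CX.le_closure CX.closure_closed by auto
    then show ?thesis
      unfolding arr by (intro CY.closure_eqI struct[OF X Y f])
  qed
  have lattice: "suplattice (fobj ?B X)" if "X \<in> U" for X
    using suplattice_consequence.suplattice_theory_lattice[OF cons[OF that]] by (simp add: obj)
  have func: "is_functor U ?B"
    unfolding is_functor_def
  proof (intro conjI ballI)
    fix X assume X: "X \<in> U"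
    show "suplattice (fobj ?B X)" using lattice[OF X] .
    show "farr ?B X X (\<lambda>x\<in>X. x) b = b" if b: "b \<in> fcarrier ?B X" for b
    proof -
      obtain a where a: "a \<in> fcarrier A X" "b = ?c X a" using b surj[OF X] by auto
      have "farr A X X (\<lambda>x\<in>X. x) a = a" using A X a by (simp add: is_functor_def)
      then show ?thesis using nat[OF X X _ a(1), of "\<lambda>x\<in>X. x"] a by simp
    qed
    fix Y f assume Y: "Y \<in> U" and f: "f \<in> X \<rightarrow>\<^sub>E Y"
    show "farr ?B X Y f \<in> sup_hom (fobj ?B X) (fobj ?B Y)"
      using nat[OF X Y f]
      by (rule sup_hom_factor[OF chom[OF X] surj[OF X]
            sup_hom_comp[OF functor_sup_hom[OF A X Y f] chom[OF Y]] functor_suplattice[OF A X]])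
  next
    fix X Y Z f g b
    assume X: "X \<in> U" and Y: "Y \<in> U" and Z: "Z \<in> U" and f: "f \<in> X \<rightarrow>\<^sub>E Y" and g: "g \<in> Y \<rightarrow>\<^sub>E Z"
      and b: "b \<in> fcarrier ?B X"
    obtain a where a: "a \<in> fcarrier A X" "b = ?c X a" using b surj[OF X] by auto
    have "compose X g f \<in> X \<rightarrow>\<^sub>E Z" using f g by (auto simp: compose_def)
    then have "farr ?B X Z (compose X g f) b = ?c Z (farr A X Z (compose X g f) a)"
      using nat[OF X Z] a by simp
    also have "farr A X Z (compose X g f) a = farr A Y Z g (farr A X Y f a)"
      using A X Y Z f g a by (simp add: is_functor_def)
    also have "?c Z \<dots> = farr ?B Y Z g (farr ?B X Y f b)"
      using nat[OF X Y f] nat[OF Y Z g] a functor_closed[OF A X Y f] by simp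
    finally show "farr ?B X Z (compose X g f) b = farr ?B Y Z g (farr ?B X Y f b)" .
  qed
  have "nat_trans U A ?B ?c"
    unfolding nat_trans_def by (intro conjI ballI chom nat[symmetric])
  with func surj show "theory_quotient A R \<in> quotient_maps U A"
    unfolding quotient_maps_def theory_quotient_def mem_Collect_eq case_prod_conv
    by (intro conjI ballI)
  have "(x, y) \<in> induced_consequence U A (theory_quotient A R) X \<longleftrightarrow> (x, y) \<in> R X" for X x y
  proof (cases "X \<in> U")
    case True
    interpret suplattice_consequence "fobj A X" "R X" by (rule cons[OF True])
    have "(x, y) \<in> induced_consequence U A (theory_quotient A R) X \<longleftrightarrow>
        x \<in> fcarrier A X \<and> y \<in> fcarrier A X \<and> ?c X y \<sqsubseteq>\<^bsub>fobj A X\<^esub> ?c X x"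
      by (simp add: mem_induced_consequence[OF True] theory_quotient_def obj theory_lattice_def)
    then show ?thesis
      using rel_iff_closure_le rel_closed by blast
  next
    case False
    then show ?thesis
      using R by (auto simp: induced_consequence_def structural_consequence_relations_def)
  qed
  then show "induced_consequence U A (theory_quotient A R) = R"
    by (intro ext set_eqI) auto
qed

section \<open>The correspondence\<close>

lemma bij_betw_fibres:
  assumes "f ` S = T"
  shows "bij_betw (\<lambda>y. {x \<in> S. f x = y}) T (S // {(x, x') \<in> S \<times> S. f x = f x'})"
proof (rule bij_betw_imageI)
  show "inj_on (\<lambda>y. {x \<in> S. f x = y}) T"
    using assms by (intro inj_onI) blast
  show "(\<lambda>y. {x \<in> S. f x = y}) ` T = S // {(x, x') \<in> S \<times> S. f x = f x'}"
    unfolding assms[symmetric] quotient_def UNION_singleton_eq_range image_image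
    by (rule image_cong) auto
qed

theorem proposition3p5:
  fixes U :: "'u set set" and A :: "('u, 'b) set_supl_functor"
  assumes "is_functor U A"
  shows "bij_betw
           (\<lambda>R. {Q \<in> quotient_maps U A. induced_consequence U A Q = R})
           (structural_consequence_relations U A)
           ((quotient_maps U A :: ('u, 'b, 'b) quotient_map set) // same_quotient_rel U A)
       \<and> (\<forall>Q \<in> (quotient_maps U A :: ('u, 'b, 'c) quotient_map set).
            \<exists>Q' \<in> (quotient_maps U A :: ('u, 'b, 'b) quotient_map set). same_quotient U A Q' Q)"
proof (intro conjI ballI)
  let ?QM = "quotient_maps U A :: ('u, 'b, 'b) quotient_map set"
  have "induced_consequence U A ` ?QM = structural_consequence_relations U A"
    using induced_consequence_structural[OF assms] theory_quotient[OF assms]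
    by (auto simp: image_iff) metis
  moreover have "same_quotient_rel U A =
      {(Q1, Q2) \<in> ?QM \<times> ?QM. induced_consequence U A Q1 = induced_consequence U A Q2}"
    using same_quotient_if_induced_eq[OF assms] induced_eq_if_same_quotient
    unfolding same_quotient_rel_def by fast
  ultimately show "bij_betw
      (\<lambda>R. {Q \<in> quotient_maps U A. induced_consequence U A Q = R})
      (structural_consequence_relations U A) (?QM // same_quotient_rel U A)"
    using bij_betw_fibres[of "induced_consequence U A" ?QM] by simp
next
  fix Q :: "('u, 'b, 'c) quotient_map"
  assume Q: "Q \<in> quotient_maps U A"
  let ?Q' = "theory_quotient A (induced_consequence U A Q)"
  note R = induced_consequence_structural[OF assms Q]
  have "same_quotient U A ?Q' Q"
    using theory_quotient[OF assms R] Q by (intro same_quotient_if_induced_eq[OF assms])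
  then show "\<exists>Q' \<in> (quotient_maps U A :: ('u, 'b, 'b) quotient_map set). same_quotient U A Q' Q"
    using theory_quotient(1)[OF assms R] by blast
qed

end
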